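(* [Approximate Bayes' test] Let $\bar{\mathbf Y}$ and $\bar{\mathbf Z}$ be random vectors of the same dimension $n$, all of whose coordinates are Bernoulli random variables, with parameter vectors $\bar{\mathbf\Theta}$ and $\bar{\mathbf\Theta}'$ respectively (random vectors, in the Bayesian sense), and suppose that $\|\bar{\mathbf\Theta}-\bar{\mathbf\Theta}'\|_\infty\le\delta$. Let $D\subseteq\mathbb R^n$ satisfy $P(\bar{\mathbf\Theta}\in D)\in(0,1)$, and consider the hypotheses $$H_0:\bar{\mathbf\Theta}\in D\quad\text{vs}\quad H_1:\bar{\mathbf\Theta}\in D^c .$$ Let $\alpha,\beta\in(0,1)$ and put $$r_1=\frac{P(\bar{\mathbf\Theta}\in D)}{P(\bar{\mathbf\Theta}\in D^{+}_{2\delta})},\qquad r_2=\frac{P(\bar{\mathbf\Theta}\in D^c)}{P(\bar{\mathbf\Theta}\in (D^c)^{+}_{2\delta})}.$$ Let $\bar{\mathbf z}=(\mathbf z_1,\dots,\mathbf z_N)$ be a sequence of $N$ samples from $\bar{\mathbf Z}$, and consider the test that - accepts $H_0$ when $\mathbb B_{\bar{\mathbf Z}}(\bar{\mathbf z},D^{-}_{\delta})\ge\frac{1}{\beta r_2}$, and - rejects $H_0$ when $\mathbb B_{\bar{\mathbf Z}}(\bar{\mathbf z},D^{+}_{\delta})\le\alpha r_1$. Then $\alpha$ and $\beta$ are upper bounds of the Type-I and Type-II errors of this test respectively, i.e. $P(\text{reject }H_0\mid H_0)\le\alpha$ and $P(\text{accept }H_0\mid H_1)\le\beta$.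
   Context: Bayesian setting: the parameter vector $\bar{\mathbf\Theta}=(\Theta_1,\dots,\Theta_n)$ of $\bar{\mathbf Y}=(Y_1,\dots,Y_n)$ is itself a random vector with a known joint density (the prior), and likewise $\bar{\mathbf\Theta}'$ for $\bar{\mathbf Z}$; $\bar{\mathbf\Theta},\bar{\mathbf\Theta}'$ and the data live on a common probability space, and the bound $\|\bar{\mathbf\Theta}-\bar{\mathbf\Theta}'\|_\infty\le\delta$ holds pointwise. $Y_i$ is Bernoulli with parameter $\Theta_i$ and $Z_i$ is Bernoulli with parameter $\Theta_i'$. Here $\|x\|_\infty=\max_i|x_i|$. Let $\Omega$ be the sample space (range of values) of the parameter vector, and let $A^c=\Omega\setminus A$. For $\epsilon>0$ let $B_\epsilon(x)=\{y:\|x-y\|_\infty\le\epsilon\}$. The $\epsilon$-expansion and $\epsilon$-reduction of a set $A$ are $$A^{+}_{\epsilon}=\{x\in\Omega: B_\epsilon(x)\cap A\ne\emptyset\},\qquad A^{-}_{\epsilon}=\Omega\setminus (A^c)^{+}_{\epsilon}.$$ Bayes' factor: for a set $A$ and data $\bar{\mathbf z}$ (a sequence of samples from $\bar{\mathbf Z}$), $$\mathbb B_{\bar{\mathbf Z}}(\bar{\mathbf z},A)=\frac{P(\bar{\mathbf z}\mid\bar{\mathbf\Theta}'\in A)}{P(\bar{\mathbf z}\mid\bar{\mathbf\Theta}'\in A^c)},$$ the ratio of the conditional probabilities of observing $\bar{\mathbf z}$. When $\bar{\mathbf\Theta}'$ has density $f$ this equals $\frac{\int_{A}P(\bar{\mathbf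 z}\mid\theta)f(\theta)\,d\theta}{\int_{A^c}P(\bar{\mathbf z}\mid\theta)f(\theta)\,d\theta}\cdot\frac{P_1}{P_0}$ with $P_0=\int_A f$, $P_1=\int_{A^c}f$. The Bayes' factors used in the test are understood to be defined. Type-I error: the probability of rejecting $H_0$ given that $H_0$ is true. Type-II error: the probability of accepting $H_0$ given that $H_0$ is false. *)

theory Defs
  imports "HOL-Probability.Probability"
begin

definition inf_ball :: "real \<Rightarrow> real ^ 'n \<Rightarrow> (real ^ 'n) set" where
  "inf_ball \<epsilon> x = {y. infnorm (x - y) \<le> \<epsilon>}"

text \<open>The first argument of the next two definitions is the set of possible parameter
  values; complements of parameter sets are always taken relative to it.\<close>

definition expansion :: "(real ^ 'n) set \<Rightarrow> real \<Rightarrow> (real ^ 'n) set \<Rightarrow> (real ^ 'n) set" where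
  "expansion \<Omega> \<epsilon> A = {x \<in> \<Omega>. inf_ball \<epsilon> x \<inter> A \<noteq> {}}"

definition reduction :: "(real ^ 'n) set \<Rightarrow> real \<Rightarrow> (real ^ 'n) set \<Rightarrow> (real ^ 'n) set" where
  "reduction \<Omega> \<epsilon> A = \<Omega> - expansion \<Omega> \<epsilon> (\<Omega> - A)"

text \<open>A version of the conditional probability of the event \<open>P\<close> given the random parameter
  \<open>\<Theta>\<close>, i.e. given the sigma-algebra generated by \<open>\<Theta>\<close>.\<close>

definition prob_given ::
  "'a measure \<Rightarrow> ('a \<Rightarrow> real ^ 'n) \<Rightarrow> ('a \<Rightarrow> bool) \<Rightarrow> 'a \<Rightarrow> real" where
  "prob_given M \<Theta> P =
     real_cond_exp M (vimage_algebra (space M) \<Theta> borel) (indicator {\<omega> \<in> space M. P \<omega>})"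

text \<open>Given \<open>\<Theta>\<close>, every coordinate \<open>Y $ i\<close> has the Bernoulli distribution with parameter
  \<open>\<Theta> $ i\<close>.  The coordinates need not be conditionally independent.  The range condition
  is needed because \<open>bernoulli_pmf\<close> truncates its argument to the unit interval.\<close>

definition bernoulli_vector ::
  "'a measure \<Rightarrow> ('a \<Rightarrow> real ^ 'n) \<Rightarrow> ('a \<Rightarrow> bool ^ 'n) \<Rightarrow> bool" where
  "bernoulli_vector M \<Theta> Y \<longleftrightarrow>
     Y \<in> measurable M (count_space UNIV) \<and>
     (\<forall>\<omega>\<in>space M. \<forall>i. 0 \<le> \<Theta> \<omega> $ i \<and> \<Theta> \<omega> $ i \<le> 1) \<and>
     (\<forall>i b. AE \<omega> in M.
        prob_given M \<Theta> (\<lambda>\<omega>. Y \<omega> $ i = b) \<omega> = pmf (bernoulli_pmf (\<Theta> \<omega> $ i)) b)"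

text \<open>Given \<open>\<Theta>\<close>, the vectors \<open>z 0, \<dots>, z (N - 1)\<close> are independent and each of them has the
  conditional distribution of \<open>Z\<close>.\<close>

definition samples_from ::
  "'a measure \<Rightarrow> ('a \<Rightarrow> real ^ 'n) \<Rightarrow> ('a \<Rightarrow> bool ^ 'n) \<Rightarrow> nat \<Rightarrow> (nat \<Rightarrow> 'a \<Rightarrow> bool ^ 'n) \<Rightarrow> bool" where
  "samples_from M \<Theta> Z N z \<longleftrightarrow>
     (\<forall>j<N. z j \<in> measurable M (count_space UNIV)) \<and>
     (\<forall>v. AE \<omega> in M.
        prob_given M \<Theta> (\<lambda>\<omega>. \<forall>j<N. z j \<omega> = v j) \<omega> =
        (\<Prod>j<N. prob_given M \<Theta> (\<lambda>\<omega>. Z \<omega> = v j) \<omega>))"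

text \<open>A data sequence of length \<open>N\<close> is represented by a function \<open>v\<close> on the naturals of which
  only the values below \<open>N\<close> matter.\<close>

definition likelihood ::
  "'a measure \<Rightarrow> ('a \<Rightarrow> real ^ 'n) \<Rightarrow> nat \<Rightarrow> (nat \<Rightarrow> 'a \<Rightarrow> bool ^ 'n) \<Rightarrow>
   (nat \<Rightarrow> bool ^ 'n) \<Rightarrow> (real ^ 'n) set \<Rightarrow> real" where
  "likelihood M \<Theta> N z v A = \<P>(\<omega> in M. (\<forall>j<N. z j \<omega> = v j) \<bar> \<Theta> \<omega> \<in> A)"

definition bayes_factor ::
  "'a measure \<Rightarrow> (real ^ 'n) set \<Rightarrow> ('a \<Rightarrow> real ^ 'n) \<Rightarrow> nat \<Rightarrow> (nat \<Rightarrow> 'a \<Rightarrow> bool ^ 'n) \<Rightarrow>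
   (nat \<Rightarrow> bool ^ 'n) \<Rightarrow> (real ^ 'n) set \<Rightarrow> real" where
  "bayes_factor M \<Omega> \<Theta> N z v A =
     likelihood M \<Theta> N z v A / likelihood M \<Theta> N z v (\<Omega> - A)"

text \<open>Division by zero being total, definedness of the two conditional probabilities and of
  their quotient has to be expressed separately.\<close>

definition bayes_factor_defined ::
  "'a measure \<Rightarrow> (real ^ 'n) set \<Rightarrow> ('a \<Rightarrow> real ^ 'n) \<Rightarrow> nat \<Rightarrow> (nat \<Rightarrow> 'a \<Rightarrow> bool ^ 'n) \<Rightarrow>
   (nat \<Rightarrow> bool ^ 'n) \<Rightarrow> (real ^ 'n) set \<Rightarrow> bool" where
  "bayes_factor_defined M \<Omega> \<Theta> N z v A \<longleftrightarrow>
     \<P>(\<omega> in M. \<Theta> \<omega> \<in> A) \<noteq> 0 \<and> \<P>(\<omega> in M. \<Theta> \<omega> \<in> \<Omega> - A) \<noteq> 0 \<and>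
     likelihood M \<Theta> N z v (\<Omega> - A) \<noteq> 0"

end

theory Submission
  imports Defs
begin

text \<open>By the triangle inequality
  \<open>{\<Theta> \<in> D} \<subseteq> {\<Theta>' \<in> D\<^sup>+\<^sub>\<delta>} \<subseteq> {\<Theta> \<in> D\<^sup>+\<^sub>2\<^sub>\<delta>}\<close>.  A data sequence on which \<open>H\<^sub>0\<close> is rejected is
  at most \<open>\<alpha> r1\<close> times as likely given \<open>\<Theta>' \<in> D\<^sup>+\<^sub>\<delta>\<close> as given the complement, so summing over the
  rejection region bounds its probability given \<open>\<Theta>' \<in> D\<^sup>+\<^sub>\<delta>\<close> by \<open>\<alpha> r1\<close>.  The factor \<open>r1\<close> pays for
  replacing the condition \<open>\<Theta>' \<in> D\<^sup>+\<^sub>\<delta>\<close> by \<open>\<Theta> \<in> D\<close>.  The Type-II error is the same with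
  \<open>\<Omega> - D\<close> in place of \<open>D\<close>, since \<open>D\<^sup>-\<^sub>\<delta>\<close> is the complement of the expansion of \<open>\<Omega> - D\<close>.\<close>

text \<open>Since \<open>T\<close> takes finitely many values, the pointwise inequality can be
  summed over the values satisfying \<open>Q\<close>. The conditional probabilities given
  \<open>B\<close> sum to at most 1, which leaves the factor \<open>c\<close>. The conclusion bounds
  a joint probability, so that it can be compared directly with events contained in \<open>A\<close>
  or containing it.\<close>

lemma (in prob_space) likelihood_ratio_bound:
  fixes T :: "'a \<Rightarrow> 'b" and c :: real
  assumes fin: "finite (T ` space M)"
    and T: "\<And>t. {\<omega> \<in> space M. T \<omega> = t} \<in> events"
    and A: "{\<omega> \<in> space M. A \<omega>} \<in> events" and B: "{\<omega> \<in> space M. B \<omega>} \<in> events"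
    and "0 \<le> c"
    and ratio: "AE \<omega> in M. Q (T \<omega>) \<longrightarrow>
      \<P>(\<omega>' in M. T \<omega>' = T \<omega> \<bar> A \<omega>') \<le> c * \<P>(\<omega>' in M. T \<omega>' = T \<omega> \<bar> B \<omega>')"
  shows "\<P>(\<omega> in M. Q (T \<omega>) \<and> A \<omega>) \<le> c * \<P>(\<omega> in M. A \<omega>)"
proof -
  define I where "I = {t \<in> T ` space M. Q t}"
  have finI: "finite I"
    using fin by (simp add: I_def)
  have meas: "{\<omega> \<in> space M. T \<omega> = t \<and> C \<omega>} \<in> events"
    if "{\<omega> \<in> space M. C \<omega>} \<in> events" for t and C :: "'a \<Rightarrow> bool"
    using sets.Int[OF T[of t] that] by (simp add: Collect_conj_eq Int_ac)
  have sum_eq: "\<P>(\<omega> in M. Q (T \<omega>) \<and> C \<omega>) = (\<Sum>t\<in>I. \<P>(\<omega> in M. T \<omega> = t \<and> C \<omega>))"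
    if "{\<omega> \<in> space M. C \<omega>} \<in> events" for C :: "'a \<Rightarrow> bool"
  proof -
    have "{\<omega> \<in> space M. Q (T \<omega>) \<and> C \<omega>} = (\<Union>t\<in>I. {\<omega> \<in> space M. T \<omega> = t \<and> C \<omega>})"
      by (auto simp: I_def)
    moreover have "prob \<dots> = (\<Sum>t\<in>I. \<P>(\<omega> in M. T \<omega> = t \<and> C \<omega>))"
      using meas[OF that]
      by (intro finite_measure_finite_Union finI) (auto simp: disjoint_family_on_def)
    ultimately show ?thesis
      by simp
  qed
  \<comment> \<open>The inequality is assumed only almost everywhere, yet it holds at every value in
    \<open>I\<close>. If it failed at a value of positive probability, it would fail on the whole
    event \<open>T \<omega> = t\<close>, which is not null. At a value of probability 0 the left
    side vanishes.\<close>
  have cond: "\<P>(\<omega> in M. T \<omega> = t \<bar> A \<omega>) \<le> c * \<P>(\<omega> in M. T \<omega> = t \<bar> B \<omega>)"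
    if "t \<in> I" for t
  proof (cases "\<P>(\<omega> in M. T \<omega> = t) = 0")
    case True
    have "\<P>(\<omega> in M. T \<omega> = t \<and> A \<omega>) \<le> \<P>(\<omega> in M. T \<omega> = t)"
      by (intro finite_measure_mono T) auto
    then have "\<P>(\<omega> in M. T \<omega> = t \<and> A \<omega>) = 0"
      using True measure_nonneg[of M] by (metis order_antisym)
    then show ?thesis
      using \<open>0 \<le> c\<close> by (simp add: cond_prob_def)
  next
    case False
    have "\<not> (AE \<omega> in M. T \<omega> \<noteq> t)"
      using False T[of t] by (simp add: prob_Collect_eq_0)
    moreover have "AE \<omega> in M. T \<omega> \<noteq> t"
      if "\<not> \<P>(\<omega> in M. T \<omega> = t \<bar> A \<omega>) \<le> c * \<P>(\<omega> in M. T \<omega> = t \<bar> B \<omega>)"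
      using ratio by eventually_elim (use that \<open>t \<in> I\<close> in \<open>auto simp: I_def\<close>)
    ultimately show ?thesis
      by blast
  qed
  have "(\<Sum>t\<in>I. \<P>(\<omega> in M. T \<omega> = t \<bar> B \<omega>)) = \<P>(\<omega> in M. Q (T \<omega>) \<and> B \<omega>) / \<P>(\<omega> in M. B \<omega>)"
    by (simp add: cond_prob_def sum_eq[OF B] sum_divide_distrib)
  \<comment> \<open>If \<open>B\<close> has probability 0, the quotient is 0 by the convention for
    division, so the bound holds in that case too.\<close>
  also have "\<dots> \<le> 1"
    using B by (intro divide_le_eq_1[THEN iffD2]) (auto simp: zero_less_measure_iff
        intro!: finite_measure_mono)
  finally have B_le: "(\<Sum>t\<in>I. \<P>(\<omega> in M. T \<omega> = t \<bar> B \<omega>)) \<le> 1" .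
  have A_mult: "\<P>(\<omega> in M. T \<omega> = t \<and> A \<omega>) = \<P>(\<omega> in M. T \<omega> = t \<bar> A \<omega>) * \<P>(\<omega> in M. A \<omega>)" for t
  proof (cases "\<P>(\<omega> in M. A \<omega>) = 0")
    case True
    moreover have "\<P>(\<omega> in M. T \<omega> = t \<and> A \<omega>) \<le> \<P>(\<omega> in M. A \<omega>)"
      by (intro finite_measure_mono A) auto
    ultimately show ?thesis
      using measure_nonneg[of M] by (metis mult_zero_right order_antisym)
  qed (simp add: cond_prob_def)
  have "\<P>(\<omega> in M. Q (T \<omega>) \<and> A \<omega>) = (\<Sum>t\<in>I. \<P>(\<omega> in M. T \<omega> = t \<bar> A \<omega>)) * \<P>(\<omega> in M. A \<omega>)"
    by (simp add: sum_eq[OF A] A_mult sum_distrib_right)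
  also have "(\<Sum>t\<in>I. \<P>(\<omega> in M. T \<omega> = t \<bar> A \<omega>)) \<le> c * (\<Sum>t\<in>I. \<P>(\<omega> in M. T \<omega> = t \<bar> B \<omega>))"
    unfolding sum_distrib_left by (intro sum_mono cond)
  also have "\<dots> \<le> c"
    using B_le \<open>0 \<le> c\<close> by (simp add: mult_left_le)
  finally show ?thesis
    by (simp add: mult_right_mono)
qed

text \<open>The chain from \<open>H\<close> through \<open>A\<close> to \<open>K\<close> is used
  twice: \<open>H\<close> is replaced by the larger event \<open>A\<close>, to which the likelihood
  bound applies, and the resulting factor \<open>\<P>(\<omega> in M. A \<omega>)\<close> is absorbed
  by the probability of \<open>K\<close> in the denominator. Dividing by the probability of
  \<open>H\<close> leaves \<open>a\<close>.\<close>

lemma (in prob_space) test_error_bound: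
  fixes T :: "'a \<Rightarrow> 'b" and a :: real
  assumes fin: "finite (T ` space M)"
    and T: "\<And>t. {\<omega> \<in> space M. T \<omega> = t} \<in> events"
    and A: "{\<omega> \<in> space M. A \<omega>} \<in> events" and B: "{\<omega> \<in> space M. B \<omega>} \<in> events"
    and K: "{\<omega> \<in> space M. K \<omega>} \<in> events"
    and HA: "\<And>\<omega>. \<omega> \<in> space M \<Longrightarrow> H \<omega> \<Longrightarrow> A \<omega>" and AK: "\<And>\<omega>. \<omega> \<in> space M \<Longrightarrow> A \<omega> \<Longrightarrow> K \<omega>"
    and "0 \<le> a"
    and ratio: "AE \<omega> in M. Q (T \<omega>) \<longrightarrow>
      \<P>(\<omega>' in M. T \<omega>' = T \<omega> \<bar> A \<omega>') \<le>
        a * (\<P>(\<omega> in M. H \<omega>) / \<P>(\<omega> in M. K \<omega>)) * \<P>(\<omega>' in M. T \<omega>' = T \<omega> \<bar> B \<omega>')"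
  shows "\<P>(\<omega> in M. Q (T \<omega>) \<bar> H \<omega>) \<le> a"
proof (cases "\<P>(\<omega> in M. H \<omega>) = 0")
  case True
  then show ?thesis
    using \<open>0 \<le> a\<close> by (simp add: cond_prob_def)
next
  case False
  then have H_pos: "0 < \<P>(\<omega> in M. H \<omega>)"
    by (simp add: zero_less_measure_iff)
  \<comment> \<open>\<open>Q\<close> is an arbitrary predicate; the event is measurable because it
    is a finite union of level sets of \<open>T\<close>.\<close>
  have "{\<omega> \<in> space M. Q (T \<omega>)} = (\<Union>t\<in>{t \<in> T ` space M. Q t}. {\<omega> \<in> space M. T \<omega> = t})"
    by auto
  also have "\<dots> \<in> events"
    using fin T by (intro sets.finite_UN) auto
  finally have "{\<omega> \<in> space M. Q (T \<omega>)} \<inter> {\<omega> \<in> space M. A \<omega>} \<in> events"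
    using A by (rule sets.Int)
  then have QA: "{\<omega> \<in> space M. Q (T \<omega>) \<and> A \<omega>} \<in> events"
    by (simp add: Collect_conj_eq Int_ac)
  have AK': "\<P>(\<omega> in M. A \<omega>) \<le> \<P>(\<omega> in M. K \<omega>)"
    by (intro finite_measure_mono K) (auto simp: AK)
  have "\<P>(\<omega> in M. Q (T \<omega>) \<and> H \<omega>) \<le> \<P>(\<omega> in M. Q (T \<omega>) \<and> A \<omega>)"
    by (intro finite_measure_mono QA) (auto simp: HA)
  also have "\<dots> \<le> a * (\<P>(\<omega> in M. H \<omega>) / \<P>(\<omega> in M. K \<omega>)) * \<P>(\<omega> in M. A \<omega>)"
    by (rule likelihood_ratio_bound[OF fin T A B _ ratio]) (simp add: \<open>0 \<le> a\<close>)
  also have "\<dots> = a * \<P>(\<omega> in M. H \<omega>) * (\<P>(\<omega> in M. A \<omega>) / \<P>(\<omega> in M. K \<omega>))"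
    by simp
  also have "\<dots> \<le> a * \<P>(\<omega> in M. H \<omega>)"
    using AK' \<open>0 \<le> a\<close> by (intro mult_left_le) (auto simp: divide_le_eq_1 zero_less_measure_iff)
  finally show ?thesis
    using H_pos by (simp add: cond_prob_def pos_divide_le_eq)
qed

text \<open>Restriction gives a fixed value to every index from \<open>N\<close> on, so equality of
  the restricted functions is agreement on the \<open>N\<close> samples. This presents the data as a
  single random variable.\<close>

lemma likelihood_restrict:
  "likelihood M \<Theta> N z v A =
    \<P>(\<omega> in M. restrict (\<lambda>j. z j \<omega>) {..<N} = restrict v {..<N} \<bar> \<Theta> \<omega> \<in> A)"
  unfolding likelihood_def by (simp add: restrict_def fun_eq_iff)

lemma bayes_factor_restrict:
  "bayes_factor M \<Omega> \<Theta> N z (restrict v {..<N}) A = bayes_factor M \<Omega> \<Theta> N z v A"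
  by (simp add: bayes_factor_def likelihood_def cong: conj_cong)

text \<open>An expansion lies inside \<Omega>, so taking the complement twice gives it back.\<close>

lemma reduction_compl: "\<Omega> - reduction \<Omega> \<epsilon> A = expansion \<Omega> \<epsilon> (\<Omega> - A)"
  by (auto simp: reduction_def expansion_def)

lemma expansionI:
  assumes "x \<in> \<Omega>" "y \<in> A" "infnorm (x - y) \<le> \<epsilon>"
  shows "x \<in> expansion \<Omega> \<epsilon> A"
  using assms by (auto simp: expansion_def inf_ball_def)

lemma expansion_twice:
  assumes "y \<in> expansion \<Omega> \<delta> A" "x \<in> \<Omega>" "infnorm (x - y) \<le> \<delta>"
  shows "x \<in> expansion \<Omega> (2 * \<delta>) A"
proof -
  obtain w where w: "w \<in> A" "infnorm (y - w) \<le> \<delta>"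
    using assms(1) by (auto simp: expansion_def inf_ball_def)
  have "infnorm (x - w) \<le> infnorm (x - y) + infnorm (y - w)"
    using infnorm_triangle[of "x - y" "y - w"] by simp
  with w assms show ?thesis
    by (intro expansionI[of _ _ w]) auto
qed

text \<open>Both errors are instances: \<open>S\<close> is \<open>D\<close> or
  \<open>\<Omega> - D\<close>, and \<open>B\<close> is the complement of the expansion of
  \<open>S\<close>. The ratio condition is multiplied out because the likelihood of the expansion is
  the numerator of the Bayes' factor in one case and its denominator in the other.\<close>

lemma (in prob_space) bayes_test_error_bound:
  fixes \<Theta> \<Theta>' :: "'a \<Rightarrow> real ^ 'n" and z :: "nat \<Rightarrow> 'a \<Rightarrow> bool ^ 'n" and a \<delta> :: real
  assumes z: "\<And>j. j < N \<Longrightarrow> z j \<in> measurable M (count_space UNIV)"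
    and \<Theta>: "\<And>\<omega>. \<omega> \<in> space M \<Longrightarrow> \<Theta> \<omega> \<in> \<Omega>" and \<Theta>': "\<And>\<omega>. \<omega> \<in> space M \<Longrightarrow> \<Theta>' \<omega> \<in> \<Omega>"
    and close: "\<And>\<omega>. \<omega> \<in> space M \<Longrightarrow> infnorm (\<Theta> \<omega> - \<Theta>' \<omega>) \<le> \<delta>"
    and A: "{\<omega> \<in> space M. \<Theta>' \<omega> \<in> expansion \<Omega> \<delta> S} \<in> events"
    and B: "{\<omega> \<in> space M. \<Theta>' \<omega> \<in> B} \<in> events"
    and K: "{\<omega> \<in> space M. \<Theta> \<omega> \<in> expansion \<Omega> (2 * \<delta>) S} \<in> events"
    and "0 \<le> a"
    and Q: "\<And>v. Q (restrict v {..<N}) \<longleftrightarrow> Q v"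
    and ratio: "AE \<omega> in M. Q (\<lambda>j. z j \<omega>) \<longrightarrow>
      likelihood M \<Theta>' N z (\<lambda>j. z j \<omega>) (expansion \<Omega> \<delta> S) \<le>
        a * (\<P>(\<omega> in M. \<Theta> \<omega> \<in> S) / \<P>(\<omega> in M. \<Theta> \<omega> \<in> expansion \<Omega> (2 * \<delta>) S)) *
        likelihood M \<Theta>' N z (\<lambda>j. z j \<omega>) B"
  shows "\<P>(\<omega> in M. Q (\<lambda>j. z j \<omega>) \<bar> \<Theta> \<omega> \<in> S) \<le> a"
proof -
  define T where "T \<omega> = restrict (\<lambda>j. z j \<omega>) {..<N}" for \<omega>
  \<comment> \<open>The restricted sequences lie in a product of \<open>N\<close> copies of the
    finite type \<open>bool ^ 'n\<close>.\<close>
  have "T ` space M \<subseteq> PiE {..<N} (\<lambda>_. UNIV)"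
    by (intro image_subsetI) (simp add: T_def restrict_PiE_iff del: restrict_apply)
  then have fin: "finite (T ` space M)"
    by (rule finite_subset) (intro finite_PiE; simp)
  have T: "{\<omega> \<in> space M. T \<omega> = t} \<in> events" for t
  \<comment> \<open>For extensional \<open>t\<close> the level set is a finite intersection of
    events; for any other \<open>t\<close> it is empty.\<close>
  proof (cases "t \<in> extensional {..<N}")
    case True
    have "{\<omega> \<in> space M. \<forall>j\<in>{..<N}. z j \<omega> = t j} \<in> events"
    proof (rule sets.sets_Collect_finite_All)
      fix j assume "j \<in> {..<N}"
      then show "{\<omega> \<in> space M. z j \<omega> = t j} \<in> events"
        using measurable_sets[OF z, of j "{t j}"] by (simp add: vimage_def Int_def conj_commute)
    qed simp
    moreover have "T \<omega> = t \<longleftrightarrow> (\<forall>j\<in>{..<N}. z j \<omega> = t j)" for \<omega>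
      using True by (auto simp: T_def restrict_def extensional_def fun_eq_iff)
    ultimately show ?thesis
      by simp
  next
    case False
    then have "T \<omega> \<noteq> t" for \<omega>
      by (auto simp: T_def)
    then show ?thesis
      by simp
  qed
  have HA: "\<Theta>' \<omega> \<in> expansion \<Omega> \<delta> S" if "\<omega> \<in> space M" "\<Theta> \<omega> \<in> S" for \<omega>
    using that close[of \<omega>] \<Theta>'[of \<omega>] by (auto intro: expansionI[of _ _ "\<Theta> \<omega>"] simp: infnorm_sub)
  have AK: "\<Theta> \<omega> \<in> expansion \<Omega> (2 * \<delta>) S" if "\<omega> \<in> space M" "\<Theta>' \<omega> \<in> expansion \<Omega> \<delta> S" for \<omega>
    using that(2) \<Theta>[OF that(1)] close[OF that(1)] by (rule expansion_twice)
  have "\<P>(\<omega> in M. Q (T \<omega>) \<bar> \<Theta> \<omega> \<in> S) \<le> a"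
    using ratio
    by (intro test_error_bound[OF fin T A B K HA AK \<open>0 \<le> a\<close>])
      (simp_all only: T_def Q likelihood_restrict)
  then show ?thesis
    by (simp only: T_def Q)
qed

theorem theorem5:
  fixes M :: "'a measure"
    and \<Theta> \<Theta>' :: "'a \<Rightarrow> real ^ 'n"
    and f f' :: "real ^ 'n \<Rightarrow> ennreal"
    and \<Omega> D :: "(real ^ 'n) set"
    and Y Z :: "'a \<Rightarrow> bool ^ 'n"
    and z :: "nat \<Rightarrow> 'a \<Rightarrow> bool ^ 'n"
    and N :: nat
    and \<delta> \<alpha> \<beta> r1 r2 :: real
  assumes "prob_space M"
    and "distributed M lborel \<Theta> f"
    and "distributed M lborel \<Theta>' f'"
    and "\<And>\<omega>. \<omega> \<in> space M \<Longrightarrow> \<Theta> \<omega> \<in> \<Omega>"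
    and "\<And>\<omega>. \<omega> \<in> space M \<Longrightarrow> \<Theta>' \<omega> \<in> \<Omega>"
    and "bernoulli_vector M \<Theta> Y"
    and "bernoulli_vector M \<Theta>' Z"
    and "\<And>\<omega>. \<omega> \<in> space M \<Longrightarrow> infnorm (\<Theta> \<omega> - \<Theta>' \<omega>) \<le> \<delta>"
    and "{\<omega> \<in> space M. \<Theta> \<omega> \<in> D} \<in> sets M"
    and "{\<omega> \<in> space M. \<Theta> \<omega> \<in> expansion \<Omega> (2 * \<delta>) D} \<in> sets M"
    and "{\<omega> \<in> space M. \<Theta> \<omega> \<in> expansion \<Omega> (2 * \<delta>) (\<Omega> - D)} \<in> sets M"
    and "{\<omega> \<in> space M. \<Theta>' \<omega> \<in> expansion \<Omega> \<delta> D} \<in> sets M"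
    and "{\<omega> \<in> space M. \<Theta>' \<omega> \<in> reduction \<Omega> \<delta> D} \<in> sets M"
    and "0 < \<P>(\<omega> in M. \<Theta> \<omega> \<in> D)" and "\<P>(\<omega> in M. \<Theta> \<omega> \<in> D) < 1"
    and "0 < \<alpha>" and "\<alpha> < 1" and "0 < \<beta>" and "\<beta> < 1"
    and "r1 = \<P>(\<omega> in M. \<Theta> \<omega> \<in> D) / \<P>(\<omega> in M. \<Theta> \<omega> \<in> expansion \<Omega> (2 * \<delta>) D)"
    and "r2 = \<P>(\<omega> in M. \<Theta> \<omega> \<in> \<Omega> - D) / \<P>(\<omega> in M. \<Theta> \<omega> \<in> expansion \<Omega> (2 * \<delta>) (\<Omega> - D))"
    and "samples_from M \<Theta>' Z N z"
    and "AE \<omega> in M. bayes_factor_defined M \<Omega> \<Theta>' N z (\<lambda>j. z j \<omega>) (reduction \<Omega> \<delta> D)"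
    and "AE \<omega> in M. bayes_factor_defined M \<Omega> \<Theta>' N z (\<lambda>j. z j \<omega>) (expansion \<Omega> \<delta> D)"
  shows "\<P>(\<omega> in M. bayes_factor M \<Omega> \<Theta>' N z (\<lambda>j. z j \<omega>) (expansion \<Omega> \<delta> D) \<le> \<alpha> * r1
             \<bar> \<Theta> \<omega> \<in> D) \<le> \<alpha>
       \<and> \<P>(\<omega> in M. bayes_factor M \<Omega> \<Theta>' N z (\<lambda>j. z j \<omega>) (reduction \<Omega> \<delta> D) \<ge> 1 / (\<beta> * r2)
             \<bar> \<Theta> \<omega> \<in> \<Omega> - D) \<le> \<beta>"
proof -
  interpret prob_space M by fact
  have z: "z j \<in> measurable M (count_space UNIV)" if "j < N" for j
    using \<open>samples_from M \<Theta>' Z N z\<close> that by (simp add: samples_from_def)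
  have compl: "{\<omega> \<in> space M. \<Theta>' \<omega> \<in> \<Omega> - C} \<in> events"
    if "{\<omega> \<in> space M. \<Theta>' \<omega> \<in> C} \<in> events" for C
  proof -
    have "{\<omega> \<in> space M. \<Theta>' \<omega> \<in> \<Omega> - C} = space M - {\<omega> \<in> space M. \<Theta>' \<omega> \<in> C}"
      using assms(5) by auto
    with that show ?thesis
      by auto
  qed
  have lik_nonneg: "0 \<le> likelihood M \<Theta>' N z v C" for v C
    by (simp add: likelihood_def cond_prob_def)
  have "\<P>(\<omega> in M. bayes_factor M \<Omega> \<Theta>' N z (\<lambda>j. z j \<omega>) (expansion \<Omega> \<delta> D) \<le> \<alpha> * r1
      \<bar> \<Theta> \<omega> \<in> D) \<le> \<alpha>"
  proof (rule bayes_test_error_bound[OF z assms(4,5,8,12) compl[OF assms(12)] assms(10)])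
    show "AE \<omega> in M. bayes_factor M \<Omega> \<Theta>' N z (\<lambda>j. z j \<omega>) (expansion \<Omega> \<delta> D) \<le> \<alpha> * r1 \<longrightarrow>
      likelihood M \<Theta>' N z (\<lambda>j. z j \<omega>) (expansion \<Omega> \<delta> D) \<le>
        \<alpha> * (\<P>(\<omega> in M. \<Theta> \<omega> \<in> D) / \<P>(\<omega> in M. \<Theta> \<omega> \<in> expansion \<Omega> (2 * \<delta>) D)) *
        likelihood M \<Theta>' N z (\<lambda>j. z j \<omega>) (\<Omega> - expansion \<Omega> \<delta> D)"
      using assms(24)
    proof (rule AE_mp, intro AE_I2 impI)
      fix \<omega>
      assume "bayes_factor_defined M \<Omega> \<Theta>' N z (\<lambda>j. z j \<omega>) (expansion \<Omega> \<delta> D)"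
      \<comment> \<open>Definedness only says that the denominator is nonzero; with nonnegativity it
        becomes positive, so the threshold inequality can be multiplied by it.\<close>
      then have "0 < likelihood M \<Theta>' N z (\<lambda>j. z j \<omega>) (\<Omega> - expansion \<Omega> \<delta> D)"
        using lik_nonneg by (simp add: bayes_factor_defined_def less_le)
      moreover assume "bayes_factor M \<Omega> \<Theta>' N z (\<lambda>j. z j \<omega>) (expansion \<Omega> \<delta> D) \<le> \<alpha> * r1"
      ultimately show "likelihood M \<Theta>' N z (\<lambda>j. z j \<omega>) (expansion \<Omega> \<delta> D) \<le>
        \<alpha> * (\<P>(\<omega> in M. \<Theta> \<omega> \<in> D) / \<P>(\<omega> in M. \<Theta> \<omega> \<in> expansion \<Omega> (2 * \<delta>) D)) *
        likelihood M \<Theta>' N z (\<lambda>j. z j \<omega>) (\<Omega> - expansion \<Omega> \<delta> D)"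
        unfolding assms(20)[symmetric] by (simp add: bayes_factor_def pos_divide_le_eq)
    qed
  qed (use \<open>0 < \<alpha>\<close> in \<open>simp_all only: bayes_factor_restrict less_imp_le\<close>)
  moreover have "\<P>(\<omega> in M. bayes_factor M \<Omega> \<Theta>' N z (\<lambda>j. z j \<omega>) (reduction \<Omega> \<delta> D) \<ge> 1 / (\<beta> * r2)
      \<bar> \<Theta> \<omega> \<in> \<Omega> - D) \<le> \<beta>"
  \<comment> \<open>The event for the expansion of \<open>\<Omega> - D\<close> is measurable as the
    complement of the event for the reduction of \<open>D\<close>.\<close>
  proof (rule bayes_test_error_bound[OF z assms(4,5,8) compl[OF assms(13), unfolded reduction_compl]
        assms(13) assms(11)])
    \<comment> \<open>The threshold \<open>1 / (\<beta> * r2)\<close> can be inverted only if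
      \<open>r2\<close> is positive. Its numerator is positive because \<open>D\<close> has
      probability below 1, and its denominator is at least as large because a set lies in its
      expansion.\<close>
    have "{\<omega> \<in> space M. \<Theta> \<omega> \<in> \<Omega> - D} = space M - {\<omega> \<in> space M. \<Theta> \<omega> \<in> D}"
      using assms(4) by auto
    then have "0 < \<P>(\<omega> in M. \<Theta> \<omega> \<in> \<Omega> - D)"
      using assms(9,15) by (simp add: prob_compl)
    moreover have "\<P>(\<omega> in M. \<Theta> \<omega> \<in> \<Omega> - D) \<le> \<P>(\<omega> in M. \<Theta> \<omega> \<in> expansion \<Omega> (2 * \<delta>) (\<Omega> - D))"
    proof (intro finite_measure_mono assms(11) Collect_mono impI conjI; elim conjE)
      fix \<omega> assume \<omega>: "\<omega> \<in> space M" "\<Theta> \<omega> \<in> \<Omega> - D"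
      \<comment> \<open>A bound on a norm at some sample point is nonnegative, so each point belongs
        to its own ball and serves as the witness.\<close>
      have "0 \<le> 2 * \<delta>"
        using infnorm_pos_le[of "\<Theta> \<omega> - \<Theta>' \<omega>"] assms(8)[OF \<omega>(1)] by linarith
      with \<omega>(2) show "\<Theta> \<omega> \<in> expansion \<Omega> (2 * \<delta>) (\<Omega> - D)"
        by (intro expansionI[of _ _ "\<Theta> \<omega>"]) (auto simp: infnorm_0)
    qed
    ultimately have "0 < \<beta> * r2"
      using \<open>0 < \<beta>\<close> by (simp add: assms(21))
    show "AE \<omega> in M. bayes_factor M \<Omega> \<Theta>' N z (\<lambda>j. z j \<omega>) (reduction \<Omega> \<delta> D) \<ge> 1 / (\<beta> * r2) \<longrightarrow>
      likelihood M \<Theta>' N z (\<lambda>j. z j \<omega>) (expansion \<Omega> \<delta> (\<Omega> - D)) \<le>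
        \<beta> * (\<P>(\<omega> in M. \<Theta> \<omega> \<in> \<Omega> - D) / \<P>(\<omega> in M. \<Theta> \<omega> \<in> expansion \<Omega> (2 * \<delta>) (\<Omega> - D))) *
        likelihood M \<Theta>' N z (\<lambda>j. z j \<omega>) (reduction \<Omega> \<delta> D)"
      using assms(23)
    proof (rule AE_mp, intro AE_I2 impI)
      fix \<omega>
      assume "bayes_factor_defined M \<Omega> \<Theta>' N z (\<lambda>j. z j \<omega>) (reduction \<Omega> \<delta> D)"
      then have "0 < likelihood M \<Theta>' N z (\<lambda>j. z j \<omega>) (expansion \<Omega> \<delta> (\<Omega> - D))"
        using lik_nonneg by (simp add: bayes_factor_defined_def less_le reduction_compl)
      moreover assume "bayes_factor M \<Omega> \<Theta>' N z (\<lambda>j. z j \<omega>) (reduction \<Omega> \<delta> D) \<ge> 1 / (\<beta> * r2)"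
      ultimately show "likelihood M \<Theta>' N z (\<lambda>j. z j \<omega>) (expansion \<Omega> \<delta> (\<Omega> - D)) \<le>
        \<beta> * (\<P>(\<omega> in M. \<Theta> \<omega> \<in> \<Omega> - D) / \<P>(\<omega> in M. \<Theta> \<omega> \<in> expansion \<Omega> (2 * \<delta>) (\<Omega> - D))) *
        likelihood M \<Theta>' N z (\<lambda>j. z j \<omega>) (reduction \<Omega> \<delta> D)"
        \<comment> \<open>Here the expansion's likelihood is the denominator of the Bayes' factor.
          Cross-multiplying by it and by \<open>\<beta> * r2\<close>, both positive, turns the lower
          bound on the factor into the required upper bound on that likelihood.\<close>
        unfolding assms(21)[symmetric] using \<open>0 < \<beta> * r2\<close>
        by (simp only: bayes_factor_def reduction_compl frac_le_eq pos_le_divide_eq pos_divide_le_eq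
            times_divide_eq_left mult_1 mult.commute[of "likelihood _ _ _ _ _ _" "\<beta> * r2"])
    qed
  qed (use \<open>0 < \<beta>\<close> in \<open>simp_all only: bayes_factor_restrict less_imp_le\<close>)
  ultimately show ?thesis ..
qed

end
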